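(* Let $(\mathcal{S},\mathcal{A},P)$ be the state space, action space and transition probabilities of an MDP, and let $s_t,a_t\to s_{t+1}$ be an observed transition, so $P(s_{t+1}\mid s_t,a_t)>0$. Let $\tilde P_t^{LB}(\tilde s'\mid \tilde s,\tilde a)$ and $\tilde P_t^{UB}(\tilde s'\mid \tilde s,\tilde a)$ be the minimum and maximum of $\tilde P_t^{\theta}(\tilde s'\mid \tilde s,\tilde a)$ over all feasible $\theta$ (feasibility, including counterfactual stability and monotonicity, as defined in the context). Then for the observed state-action pair $(s_t,a_t)$: $$\tilde P_t^{LB}(s_{t+1}\mid s_t,a_t)=\tilde P_t^{UB}(s_{t+1}\mid s_t,a_t)=1,$$ $$\forall \tilde s'\in\mathcal{S}\setminus\{s_{t+1}\}:\quad \tilde P_t^{LB}(\tilde s'\mid s_t,a_t)=\tilde P_t^{UB}(\tilde s'\mid s_t,a_t)=0.$$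
   Context: $\mathcal{S}$ (states) and $\mathcal{A}$ (actions) are finite nonempty sets and $P(\cdot\mid s,a)$ is a probability distribution on $\mathcal{S}$ for every $(s,a)\in\mathcal{S}\times\mathcal{A}$. Canonical SCM: let $U_t$ be the finite set indexing all functions $\mathcal{S}\times\mathcal{A}\to\mathcal{S}$, so $|U_t|=|\mathcal{S}|^{|\mathcal{S}||\mathcal{A}|}$; write $f(s,a,u)\in\mathcal{S}$ for the value at $(s,a)$ of the function indexed by $u\in U_t$, and $\mu_{s,a,u,s'}=1$ if $f(s,a,u)=s'$ and $0$ otherwise. A vector $\theta\in\mathbb{R}^{U_t}$ represents a distribution on $U_t$. Given the observed transition $s_t,a_t\to s_{t+1}$ with $P(s_{t+1}\mid s_t,a_t)>0$, the counterfactual probability induced by $\theta$ is $$\tilde P_t^{\theta}(\tilde s'\mid\tilde s,\tilde a)=\frac{\sum_{u\in U_t}\mu_{\tilde s,\tilde a,u,\tilde s'}\,\mu_{s_t,a_t,u,s_{t+1}}\,\theta_u}{P(s_{t+1}\mid s_t,a_t)}.$$ $\theta$ is feasible if all of the following hold: (Prob) $0\le\theta_u\le1$ for all $u$ and $\sum_u\theta_u=1$; (Int) $\sum_u\mu_{s,a,u,s'}\theta_u=P(s'\mid s,a)$ for all $s,a,s'$; (CS, counterfactual stability) for all $(\tilde s,\tilde a)\ne(s_t,a_t)$ and all $\tilde s'\ne s_{t+1}$ with $P(\tilde s'\mid s_t,a_t)>0$ and $\frac{P(s_{t+1}\mid\tilde s,\tilde a)}{P(s_{t+1}\mid s_t,a_t)}\ge\frac{P(\tilde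 s'\mid\tilde s,\tilde a)}{P(\tilde s'\mid s_t,a_t)}$, one has $\tilde P^\theta_t(\tilde s'\mid\tilde s,\tilde a)=0$; (Mon1) for all $\tilde s,\tilde a$ with $P(s_{t+1}\mid\tilde s,\tilde a)>0$: $\tilde P^\theta_t(s_{t+1}\mid\tilde s,\tilde a)\ge P(s_{t+1}\mid\tilde s,\tilde a)$; (Mon2) for all $\tilde s,\tilde a$ and all $\tilde s'\ne s_{t+1}$ with $P(\tilde s'\mid s_t,a_t)>0$: $\tilde P^\theta_t(\tilde s'\mid\tilde s,\tilde a)\le P(\tilde s'\mid\tilde s,\tilde a)$. The assertion that the minimum/maximum equals a value includes that it is attained (in particular that a feasible $\theta$ exists). *)

theory Defs
  imports "HOL-Probability.Probability"
begin

text \<open>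
  States and actions are finite types; types of HOL are nonempty, as required.
  The canonical SCM's exogenous index set is the function type itself: an index \<open>u\<close> is
  identified with the function it indexes, so \<open>f(s,a,u)\<close> is \<open>u (s, a)\<close> and
  \<open>CARD('s \<times> 'a \<Rightarrow> 's) = CARD('s) ^ (CARD('s) * CARD('a))\<close>.
\<close>

type_synonym ('s, 'a) kernel = "'s \<Rightarrow> 'a \<Rightarrow> 's pmf"

type_synonym ('s, 'a) exo = "'s \<times> 'a \<Rightarrow> 's"

definition trans_prob :: "('s, 'a) kernel \<Rightarrow> 's \<Rightarrow> 'a \<Rightarrow> 's \<Rightarrow> real" where
  "trans_prob P s a s' = pmf (P s a) s'"

definition mu :: "'s \<Rightarrow> 'a \<Rightarrow> ('s, 'a) exo \<Rightarrow> 's \<Rightarrow> real" where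
  "mu s a u s' = (if u (s, a) = s' then 1 else 0)"

text \<open>In all definitions below, \<open>s_t a_t s_t1\<close> is the observed transition
  (\<open>s_t1\<close> standing for the state at time \<open>t + 1\<close>), and \<open>s a s'\<close> is the
  counterfactual one.\<close>

definition cf_prob ::
  "('s::finite, 'a::finite) kernel \<Rightarrow> 's \<Rightarrow> 'a \<Rightarrow> 's \<Rightarrow> (('s, 'a) exo \<Rightarrow> real)
     \<Rightarrow> 's \<Rightarrow> 'a \<Rightarrow> 's \<Rightarrow> real" where
  "cf_prob P s_t a_t s_t1 \<theta> s a s' =
     (\<Sum>u\<in>UNIV. mu s a u s' * mu s_t a_t u s_t1 * \<theta> u) / trans_prob P s_t a_t s_t1"

definition prob_constraint :: "(('s::finite, 'a::finite) exo \<Rightarrow> real) \<Rightarrow> bool" where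
  "prob_constraint \<theta> \<longleftrightarrow> (\<forall>u. 0 \<le> \<theta> u \<and> \<theta> u \<le> 1) \<and> (\<Sum>u\<in>UNIV. \<theta> u) = 1"

definition interventional_constraint ::
  "('s::finite, 'a::finite) kernel \<Rightarrow> (('s, 'a) exo \<Rightarrow> real) \<Rightarrow> bool" where
  "interventional_constraint P \<theta> \<longleftrightarrow>
     (\<forall>s a s'. (\<Sum>u\<in>UNIV. mu s a u s' * \<theta> u) = trans_prob P s a s')"

definition cf_stability ::
  "('s::finite, 'a::finite) kernel \<Rightarrow> 's \<Rightarrow> 'a \<Rightarrow> 's \<Rightarrow> (('s, 'a) exo \<Rightarrow> real) \<Rightarrow> bool" where
  "cf_stability P s_t a_t s_t1 \<theta> \<longleftrightarrow>
     (\<forall>s a s'. (s, a) \<noteq> (s_t, a_t) \<and> s' \<noteq> s_t1 \<and> trans_prob P s_t a_t s' > 0 \<and>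
        trans_prob P s a s_t1 / trans_prob P s_t a_t s_t1
          \<ge> trans_prob P s a s' / trans_prob P s_t a_t s'
        \<longrightarrow> cf_prob P s_t a_t s_t1 \<theta> s a s' = 0)"

definition monotonicity1 ::
  "('s::finite, 'a::finite) kernel \<Rightarrow> 's \<Rightarrow> 'a \<Rightarrow> 's \<Rightarrow> (('s, 'a) exo \<Rightarrow> real) \<Rightarrow> bool" where
  "monotonicity1 P s_t a_t s_t1 \<theta> \<longleftrightarrow>
     (\<forall>s a. trans_prob P s a s_t1 > 0
        \<longrightarrow> cf_prob P s_t a_t s_t1 \<theta> s a s_t1 \<ge> trans_prob P s a s_t1)"

definition monotonicity2 ::
  "('s::finite, 'a::finite) kernel \<Rightarrow> 's \<Rightarrow> 'a \<Rightarrow> 's \<Rightarrow> (('s, 'a) exo \<Rightarrow> real) \<Rightarrow> bool" where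
  "monotonicity2 P s_t a_t s_t1 \<theta> \<longleftrightarrow>
     (\<forall>s a s'. s' \<noteq> s_t1 \<and> trans_prob P s_t a_t s' > 0
        \<longrightarrow> cf_prob P s_t a_t s_t1 \<theta> s a s' \<le> trans_prob P s a s')"

definition feasible ::
  "('s::finite, 'a::finite) kernel \<Rightarrow> 's \<Rightarrow> 'a \<Rightarrow> 's \<Rightarrow> (('s, 'a) exo \<Rightarrow> real) \<Rightarrow> bool" where
  "feasible P s_t a_t s_t1 \<theta> \<longleftrightarrow>
     prob_constraint \<theta> \<and> interventional_constraint P \<theta> \<and>
     cf_stability P s_t a_t s_t1 \<theta> \<and>
     monotonicity1 P s_t a_t s_t1 \<theta> \<and> monotonicity2 P s_t a_t s_t1 \<theta>"

text \<open>The bounds are relations rather than functions: \<open>is_cf_LB \<dots> v\<close> says that the minimum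
  exists, i.e. is attained by a feasible \<open>\<theta>\<close>, and equals \<open>v\<close>. This avoids the arbitrary
  value that \<open>Inf\<close> or \<open>Min\<close> would have on an empty or infinite set.\<close>

definition is_cf_LB ::
  "('s::finite, 'a::finite) kernel \<Rightarrow> 's \<Rightarrow> 'a \<Rightarrow> 's \<Rightarrow> 's \<Rightarrow> 'a \<Rightarrow> 's \<Rightarrow> real \<Rightarrow> bool" where
  "is_cf_LB P s_t a_t s_t1 s a s' v \<longleftrightarrow>
     (\<exists>\<theta>. feasible P s_t a_t s_t1 \<theta> \<and> cf_prob P s_t a_t s_t1 \<theta> s a s' = v) \<and>
     (\<forall>\<theta>. feasible P s_t a_t s_t1 \<theta> \<longrightarrow> v \<le> cf_prob P s_t a_t s_t1 \<theta> s a s')"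

definition is_cf_UB ::
  "('s::finite, 'a::finite) kernel \<Rightarrow> 's \<Rightarrow> 'a \<Rightarrow> 's \<Rightarrow> 's \<Rightarrow> 'a \<Rightarrow> 's \<Rightarrow> real \<Rightarrow> bool" where
  "is_cf_UB P s_t a_t s_t1 s a s' v \<longleftrightarrow>
     (\<exists>\<theta>. feasible P s_t a_t s_t1 \<theta> \<and> cf_prob P s_t a_t s_t1 \<theta> s a s' = v) \<and>
     (\<forall>\<theta>. feasible P s_t a_t s_t1 \<theta> \<longrightarrow> cf_prob P s_t a_t s_t1 \<theta> s a s' \<le> v)"

end

theory Submission imports Defs begin

text \<open>
  Counterfactual probabilities at the observed pair are forced by the interventional constraint:
  the indicators of \<open>u (s_t, a_t) = s'\<close> and \<open>u (s_t, a_t) = s_t1\<close> either coincide or exclude each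
  other. What remains is to exhibit a feasible \<open>\<theta>\<close>. Draw \<open>X = u (s_t, a_t)\<close> from
  \<open>p = P(\<cdot> | s_t, a_t)\<close> and, given \<open>X\<close>, all other coordinates independently; then every constraint
  concerns a single pair \<open>(s, a)\<close> with law \<open>q = P(\<cdot> | s, a)\<close>, and asks for a conditional law \<open>r\<close> of
  \<open>u (s, a)\<close> given \<open>X = s_t1 =: z\<close> with \<open>p(z) r \<le> q\<close>. If \<open>q(z) \<ge> p(z)\<close>, take the point mass at \<open>z\<close>.
  Otherwise put mass \<open>\<rho> = q(z) / p(z)\<close> on \<open>z\<close> and spread \<open>1 - \<rho>\<close> proportionally to \<open>q\<close> over the
  states not excluded by counterfactual stability. Excluded states satisfy \<open>q \<le> \<rho> p\<close>, so their
  total \<open>q\<close>-mass is at most \<open>\<rho> (1 - p(z)) = \<rho> - q(z)\<close>; hence the others carry \<open>q\<close>-mass at least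
  \<open>1 - \<rho>\<close>, and \<open>r \<le> q\<close> off \<open>z\<close>.
\<close>

lemma ex_pmf_of_weights:
  fixes f :: "'s::finite \<Rightarrow> real"
  assumes "\<And>x. 0 \<le> f x" and "(\<Sum>x\<in>UNIV. f x) = 1"
  shows "\<exists>R. \<forall>x. pmf R x = f x"
proof -
  have "(\<integral>\<^sup>+ x. ennreal (f x) \<partial>count_space UNIV) = 1"
    using assms by (simp add: nn_integral_count_space_finite)
  then have "pmf (embed_pmf f) x = f x" for x
    using assms by (simp add: pmf_embed_pmf)
  then show ?thesis by blast
qed

lemma sum_pmf_UNIV: "(\<Sum>x\<in>UNIV. pmf p x) = 1" for p :: "'s::finite pmf"
  by (rule sum_pmf_eq_1) auto

lemma pmf_bind_finite:
  fixes p :: "'x::finite pmf"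
  shows "pmf (bind_pmf p K) y = (\<Sum>x\<in>UNIV. pmf p x * pmf (K x) y)"
  by (simp add: pmf_bind integral_measure_pmf_real[where A = UNIV] mult.commute)

text \<open>The first conjunct lets \<open>R\<close> be the conditional law at \<open>z\<close> of a
  kernel averaging to \<open>q\<close>. The others are, in order, both monotonicity conditions and
  counterfactual stability at one pair.\<close>

definition stable_monotone_law :: "'s pmf \<Rightarrow> 's \<Rightarrow> 's pmf \<Rightarrow> 's pmf \<Rightarrow> bool" where
  "stable_monotone_law p z q R \<longleftrightarrow>
     (\<forall>y. pmf p z * pmf R y \<le> pmf q y) \<and> pmf q z \<le> pmf R z \<and>
     (\<forall>y. y \<noteq> z \<and> pmf p y > 0 \<longrightarrow> pmf R y \<le> pmf q y) \<and>
     (\<forall>y. y \<noteq> z \<and> pmf p y > 0 \<and> pmf q z / pmf p z \<ge> pmf q y / pmf p y \<longrightarrow> pmf R y = 0)"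

lemma ex_stable_monotone_law:
  fixes p q :: "'s::finite pmf"
  assumes po: "pmf p z > 0"
  shows "\<exists>R. stable_monotone_law p z q R"
proof (cases "pmf q z \<ge> pmf p z")
  case True
  then show ?thesis
    by (intro exI[of _ "return_pmf z"]) (auto simp: stable_monotone_law_def pmf_le_1 indicator_def)
next
  case False
  define \<rho> where "\<rho> = pmf q z / pmf p z"
  define B where "B = {y. y \<noteq> z \<and> pmf p y > 0 \<and> pmf q y / pmf p y \<le> \<rho>}"
  \<comment> \<open>States with \<open>pmf p y = 0\<close> also land in \<open>G\<close>, since
    stability forbids nothing there.\<close>
  define G where "G = - insert z B"
  define Q where "Q = sum (pmf q) G"
  have \<rho>: "0 \<le> \<rho>" "\<rho> < 1" "\<rho> * pmf p z = pmf q z"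
    using po False by (auto simp: \<rho>_def divide_simps)
  have "z \<notin> B" by (auto simp: B_def)
  have split: "sum f UNIV = f z + sum f B + sum f G" for f :: "'s \<Rightarrow> real"
  proof -
    have "sum f UNIV = sum f (insert z B) + sum f G"
      unfolding G_def Compl_eq_Diff_UNIV by (subst sum.subset_diff[of "insert z B"]) auto
    then show ?thesis using \<open>z \<notin> B\<close> by simp
  qed
  have "sum (pmf q) B \<le> (\<Sum>y\<in>B. \<rho> * pmf p y)"
    by (rule sum_mono) (auto simp: B_def divide_simps)
  also have "\<dots> \<le> \<rho> * (1 - pmf p z)"
  proof -
    have "sum (pmf p) G \<ge> 0" by (simp add: sum_nonneg)
    then have "sum (pmf p) B \<le> 1 - pmf p z"
      using split[of "pmf p"] sum_pmf_UNIV[of p] by linarith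
    then show ?thesis using \<rho> by (simp add: sum_distrib_left[symmetric] mult_left_mono)
  qed
  finally have Q: "Q \<ge> 1 - \<rho>"
    using split[of "pmf q"] sum_pmf_UNIV[of q] \<rho> by (simp add: Q_def algebra_simps)
  define f where "f y = (if y = z then \<rho> else if y \<in> G then (1 - \<rho>) / Q * pmf q y else 0)" for y
  have c: "0 \<le> (1 - \<rho>) / Q" "(1 - \<rho>) / Q \<le> 1" "Q > 0"
    using Q \<rho> by (auto simp: divide_simps)
  have "z \<notin> G" by (simp add: G_def)
  have "sum f UNIV = \<rho> + (1 - \<rho>) / Q * Q"
  proof -
    have "sum f B = 0"
      using \<open>z \<notin> B\<close> by (intro sum.neutral) (auto simp: f_def G_def)
    moreover have "sum f G = (\<Sum>y\<in>G. (1 - \<rho>) / Q * pmf q y)"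
      using \<open>z \<notin> G\<close> by (intro sum.cong) (auto simp: f_def)
    then have "sum f G = (1 - \<rho>) / Q * Q"
      unfolding sum_distrib_left[symmetric] by (simp only: Q_def)
    moreover have "f z = \<rho>" by (simp add: f_def)
    ultimately show ?thesis
      unfolding split[of f] by simp
  qed
  then have "sum f UNIV = 1" using c by simp
  moreover have "0 \<le> f y" for y using \<rho> c by (simp add: f_def)
  ultimately obtain R where R: "\<And>y. pmf R y = f y" using ex_pmf_of_weights by metis
  have le: "f y \<le> pmf q y" if "y \<noteq> z" for y
    using that c mult_right_mono[OF c(2), of "pmf q y"] by (simp add: f_def)
  \<comment> \<open>Equality at \<open>z\<close> by the choice of \<rho>; elsewhere
    \<open>f y \<le> pmf q y\<close> and \<open>pmf p z \<le> 1\<close>.\<close>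
  have "pmf p z * f y \<le> pmf q y" for y
  proof (cases "y = z")
    case False
    then have "pmf p z * f y \<le> 1 * f y"
      using \<open>0 \<le> f y\<close> by (intro mult_right_mono) (auto simp: pmf_le_1)
    with le[OF False] show ?thesis by simp
  qed (use \<rho> in \<open>simp add: f_def mult.commute\<close>)
  moreover have "pmf q z \<le> f z"
    using \<rho> mult_left_mono[OF pmf_le_1[of p z] \<rho>(1)] by (simp add: f_def)
  moreover have "f y = 0" if "y \<in> B" for y
    using that by (auto simp: f_def G_def B_def)
  ultimately show ?thesis
    using le by (intro exI[of _ R]) (auto simp: stable_monotone_law_def R B_def \<rho>_def)
qed

text \<open>The residual \<open>q - p(z) R\<close> is nonnegative with total mass
  \<open>1 - p(z)\<close>; once normalised, it serves as the law at every point other than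
  \<open>z\<close>.\<close>

lemma ex_kernel_with_prescribed_value:
  fixes p q R :: "'s::finite pmf"
  assumes le: "\<And>y. pmf p z * pmf R y \<le> pmf q y"
  shows "\<exists>K. bind_pmf p K = q \<and> K z = R"
proof -
  have sum_R: "(\<Sum>y\<in>UNIV. pmf q y - pmf p z * pmf R y) = 1 - pmf p z"
    by (simp add: sum_subtractf sum_pmf_UNIV sum_distrib_left[symmetric])
  have "\<exists>R'. \<forall>y. (1 - pmf p z) * pmf R' y = pmf q y - pmf p z * pmf R y"
  \<comment> \<open>Normalising fails here, but a nonnegative residual of total mass 0 vanishes, so
    any \<open>R'\<close> will do.\<close>
  proof (cases "pmf p z = 1")
    case True
    then have "(\<Sum>y\<in>UNIV. pmf q y - pmf p z * pmf R y) = 0" using sum_R by simp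
    then have "pmf q y - pmf p z * pmf R y = 0" for y
      using le by (subst (asm) sum_nonneg_eq_0_iff) auto
    then show ?thesis using True by simp
  next
    case False
    then have lt: "pmf p z < 1" using pmf_le_1[of p z] by linarith
    define g where "g y = (pmf q y - pmf p z * pmf R y) / (1 - pmf p z)" for y
    have "sum g UNIV = 1" using sum_R lt by (simp add: g_def sum_divide_distrib[symmetric])
    moreover have "0 \<le> g y" for y using le lt by (simp add: g_def)
    ultimately obtain R' where "\<And>y. pmf R' y = g y" using ex_pmf_of_weights by metis
    then show ?thesis using lt by (intro exI[of _ R']) (auto simp: g_def)
  qed
  then obtain R' where R': "\<And>y. (1 - pmf p z) * pmf R' y = pmf q y - pmf p z * pmf R y" by blast
  define K where "K x = (if x = z then R else R')" for x
  have "pmf (bind_pmf p K) y = pmf q y" for y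
  proof -
    have "pmf (bind_pmf p K) y = pmf p z * pmf R y + (\<Sum>x\<in>UNIV - {z}. pmf p x * pmf R' y)"
      unfolding pmf_bind_finite by (subst sum.remove[of _ z]) (auto simp: K_def)
    also have "(\<Sum>x\<in>UNIV - {z}. pmf p x * pmf R' y) = (1 - pmf p z) * pmf R' y"
      using sum_pmf_UNIV[of p] sum.remove[of UNIV z "pmf p"]
      by (simp add: sum_distrib_right[symmetric])
    finally show ?thesis using R'[of y] by simp
  qed
  then show ?thesis by (intro exI[of _ K]) (auto simp: K_def intro: pmf_eqI)
qed

lemma sum_mu_pmf:
  "(\<Sum>u\<in>UNIV. mu s a u s' * pmf D u) = pmf (map_pmf (\<lambda>u. u (s, a)) D) s'"
  for D :: "('s::finite, 'a::finite) exo pmf"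
proof -
  have "pmf (map_pmf (\<lambda>u. u (s, a)) D) s' = sum (pmf D) {u. u (s, a) = s'}"
    by (simp add: pmf_map measure_measure_pmf_finite vimage_def)
  also have "\<dots> = (\<Sum>u\<in>UNIV. mu s a u s' * pmf D u)"
    by (rule sum.mono_neutral_cong_left) (auto simp: mu_def)
  finally show ?thesis by simp
qed

lemma sum_mu_mu_pmf:
  "(\<Sum>u\<in>UNIV. mu s a u s' * mu t b u t' * pmf D u)
     = pmf (map_pmf (\<lambda>u. (u (t, b), u (s, a))) D) (t', s')"
  for D :: "('s::finite, 'a::finite) exo pmf"
proof -
  have "pmf (map_pmf (\<lambda>u. (u (t, b), u (s, a))) D) (t', s')
      = sum (pmf D) {u. u (t, b) = t' \<and> u (s, a) = s'}"
    by (simp add: pmf_map measure_measure_pmf_finite vimage_def)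
  also have "\<dots> = (\<Sum>u\<in>UNIV. mu s a u s' * mu t b u t' * pmf D u)"
    by (rule sum.mono_neutral_cong_left) (auto simp: mu_def)
  finally show ?thesis by simp
qed

lemma ex_feasible:
  fixes P :: "('s::finite, 'a::finite) kernel"
  assumes observed: "trans_prob P s_t a_t s_t1 > 0"
  shows "\<exists>\<theta>. feasible P s_t a_t s_t1 \<theta>"
proof -
  let ?p = "P s_t a_t"
  have po: "pmf ?p s_t1 > 0" using observed by (simp add: trans_prob_def)
  obtain R where R: "\<And>q. stable_monotone_law ?p s_t1 q (R q)"
    using ex_stable_monotone_law[OF po] by metis
  have "\<exists>K. bind_pmf ?p K = q \<and> K s_t1 = R q" for q
    using R by (intro ex_kernel_with_prescribed_value) (auto simp: stable_monotone_law_def)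
  then obtain K where K: "\<And>q. bind_pmf ?p (K q) = q" "\<And>q. K q s_t1 = R q"
    by metis
  \<comment> \<open>A point mass at the observed pair makes that coordinate equal \<open>x\<close>
    almost surely, while the law of \<open>u\<close> given \<open>x\<close> remains a
    product.\<close>
  define L where "L x sa =
    (if sa = (s_t, a_t) then return_pmf x else K (P (fst sa) (snd sa)) x)" for x sa
  define D where "D = bind_pmf ?p (\<lambda>x. Pi_pmf UNIV undefined (L x))"
  have component: "map_pmf (\<lambda>u. u sa) (Pi_pmf UNIV undefined (L x)) = L x sa" for x sa
    by (simp add: Pi_pmf_component)
  have marginal: "map_pmf (\<lambda>u. u (s, a)) D = P s a" for s a
    by (cases "(s, a) = (s_t, a_t)")
      (auto simp: D_def map_bind_pmf component L_def K(1) bind_return_pmf')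
  have observed_component:
    "u (s_t, a_t) = x" if "u \<in> set_pmf (Pi_pmf UNIV undefined (L x))" for x u
    using that by (auto simp: set_Pi_pmf PiE_dflt_def L_def split: if_splits)
  have joint: "map_pmf (\<lambda>u. (u (s_t, a_t), u (s, a))) D
      = bind_pmf ?p (\<lambda>x. map_pmf (Pair x) (L x (s, a)))" for s a
  proof -
    have "map_pmf (\<lambda>u. (u (s_t, a_t), u (s, a))) (Pi_pmf UNIV undefined (L x))
        = map_pmf (Pair x) (map_pmf (\<lambda>u. u (s, a)) (Pi_pmf UNIV undefined (L x)))" for x
      unfolding map_pmf_comp by (rule map_pmf_cong) (auto simp: observed_component)
    then show ?thesis by (simp add: D_def map_bind_pmf component)
  qed
  \<comment> \<open>Only \<open>x = s_t1\<close> contributes, and its weight cancels the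
    denominator.\<close>
  have cf: "cf_prob P s_t a_t s_t1 (pmf D) s a s' = pmf (L s_t1 (s, a)) s'" for s a s'
  proof -
    have Pair: "pmf (map_pmf (Pair x) M) (s_t1, s') = (if x = s_t1 then pmf M s' else 0)"
      for x and M :: "'s pmf"
      by (auto simp: pmf_map_inj' inj_on_def intro!: pmf_map_outside)
    have "pmf (bind_pmf ?p (\<lambda>x. map_pmf (Pair x) (L x (s, a)))) (s_t1, s')
        = pmf ?p s_t1 * pmf (L s_t1 (s, a)) s'"
      by (simp add: pmf_bind_finite Pair if_distrib cong: if_cong)
    then show ?thesis using po by (simp add: cf_prob_def sum_mu_mu_pmf joint trans_prob_def)
  qed
  have "prob_constraint (pmf D)"
    by (simp add: prob_constraint_def pmf_le_1 sum_pmf_UNIV)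
  moreover have "interventional_constraint P (pmf D)"
    by (simp add: interventional_constraint_def sum_mu_pmf marginal trans_prob_def)
  \<comment> \<open>Away from the observed pair \<open>L s_t1\<close> is \<open>R (P s a)\<close>;
    at that pair it is the point mass at \<open>s_t1\<close>, for which monotonicity is
    immediate.\<close>
  moreover have "cf_stability P s_t a_t s_t1 (pmf D)"
    using R unfolding cf_stability_def cf trans_prob_def stable_monotone_law_def
    by (auto simp: L_def K)
  moreover have "monotonicity1 P s_t a_t s_t1 (pmf D)"
    using R unfolding monotonicity1_def cf trans_prob_def stable_monotone_law_def
    by (auto simp: L_def K pmf_le_1)
  moreover have "monotonicity2 P s_t a_t s_t1 (pmf D)"
    using R unfolding monotonicity2_def cf trans_prob_def stable_monotone_law_def
    by (auto simp: L_def K)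
  ultimately show ?thesis unfolding feasible_def by blast
qed

lemma cf_prob_observed:
  fixes P :: "('s::finite, 'a::finite) kernel"
  assumes "trans_prob P s_t a_t s_t1 > 0" and "feasible P s_t a_t s_t1 \<theta>"
  shows "cf_prob P s_t a_t s_t1 \<theta> s_t a_t s' = (if s' = s_t1 then 1 else 0)"
proof -
  have "mu s_t a_t u s' * mu s_t a_t u s_t1 = (if s' = s_t1 then mu s_t a_t u s_t1 else 0)"
    for u :: "('s, 'a) exo"
    by (auto simp: mu_def)
  then show ?thesis
    using assms by (simp add: cf_prob_def feasible_def interventional_constraint_def)
qed

theorem theorem4p1:
  fixes P :: "('s::finite, 'a::finite) kernel"
    and s_t s_t1 :: 's and a_t :: 'a
  assumes observed: "trans_prob P s_t a_t s_t1 > 0"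
  shows "is_cf_LB P s_t a_t s_t1 s_t a_t s_t1 1 \<and>
         is_cf_UB P s_t a_t s_t1 s_t a_t s_t1 1 \<and>
         (\<forall>s' \<in> UNIV - {s_t1}.
            is_cf_LB P s_t a_t s_t1 s_t a_t s' 0 \<and>
            is_cf_UB P s_t a_t s_t1 s_t a_t s' 0)"
  \<comment> \<open>All feasible \<theta> give the same value, so a single one attains both minimum
    and maximum.\<close>
  using ex_feasible[OF observed] cf_prob_observed[OF observed]
  by (auto simp: is_cf_LB_def is_cf_UB_def)

end
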